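(* Let $I\subseteq(0,\infty)$ be an open interval, let $f:I\to\mathbb{R}$ be smooth, and let $M$ be the surface of revolution in the semi-isotropic space $\mathbb{SI}^3$ parameterized by $$r(u,v)=(r_1,r_2,r_3)(u,v)=(u\sinh v,\;u\cosh v,\;f(u)),\qquad (u,v)\in I\times\mathbb{R}.$$ If there are $\lambda_1,\lambda_2,\lambda_3\in\mathbb{R}$ such that $\bigtriangleup r_i=\lambda_i r_i$ for $i=1,2,3$, where $\bigtriangleup$ is the Laplace operator of $M$ with respect to the first fundamental form, then $(\lambda_1,\lambda_2,\lambda_3)=(0,0,\lambda)$ with $\lambda\neq 0$, and the generating curve $u\mapsto(0,u,f(u))$ is either $$\left(0,\,u,\,c_1J_0(\sqrt{\lambda}\,u)+c_2Y_0(\sqrt{\lambda}\,u)\right)\quad(\text{case }\lambda>0)$$ or $$\left(0,\,u,\,c_1I_0(\sqrt{-\lambda}\,u)+c_2K_0(\sqrt{-\lambda}\,u)\right)\quad(\text{case }\lambda<0),$$ for some $c_1,c_2\in\mathbb{R}$.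
   Context: The semi-isotropic space $\mathbb{SI}^3$ is $\mathbb{R}^3$ with the scalar product $\langle a,b\rangle=a_1b_1-a_2b_2$ (for vectors that are not both of the form $(0,0,* )$; in that exceptional case $\langle a,b\rangle=a_3b_3$). For a parameterized surface $r(u,v)$ whose tangent planes contain no vector parallel to the $z$-axis, the first fundamental form has coefficients $E=\langle r_u,r_u\rangle$, $F=\langle r_u,r_v\rangle$, $G=\langle r_v,r_v\rangle$; put $W=EG-F^2$, assumed nonzero (for the surface of revolution in the claim, $W=-u^2$). The Laplace operator of the surface is defined on smooth functions $\psi(u,v)$ by $$\bigtriangleup\psi=-\frac{1}{\sqrt{|W|}}\left\{\frac{\partial}{\partial u}\left(\frac{G\psi_u-F\psi_v}{\sqrt{|W|}}\right)-\frac{\partial}{\partial v}\left(\frac{F\psi_u-E\psi_v}{\sqrt{|W|}}\right)\right\}.$$ Bessel functions and modified Bessel functions of order zero, for $x>0$, with $\phi(n)=\sum_{m=1}^n\frac1m$ (so $\phi(0)=0$) and $\gamma$ the Euler–Mascheroni constant: $$J_0(x)=\sum_{n=0}^\infty\frac{(-1)^nx^{2n}}{2^{2n}(n!)^2},\qquad Y_0(x)=\frac2\pi\left\{\left(\ln\frac x2+\gamma\right)J_0(x)-\sum_{n=0}^\infty\frac{(-1)^n\phi(n)x^{2n}}{2^{2n}(n!)^2}\right\},$$ $$I_0(x)=\sum_{n=0}^\infty\frac{x^{2n}}{2^{2n}(n!)^2},\qquad K_0(x)=-\left(\ln\frac x2+\gamma\right)I_0(x)+\sum_{n=0}^\inf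ty\frac{\phi(n)x^{2n}}{2^{2n}(n!)^2}.$$
   Formalization: The formal theorem additionally assumes (λ1,λ2,λ3) ≠ (0,0,0): without this the claim λ ≠ 0 fails, e.g. for f constant or f = ln u, where all three coordinates are harmonic. *)

theory Defs
  imports "HOL-Analysis.Analysis"
begin

section \<open>Semi-isotropic space\<close>

definition si_inner :: "real ^ 3 \<Rightarrow> real ^ 3 \<Rightarrow> real" where
  "si_inner a b =
     (if a $ 1 = 0 \<and> a $ 2 = 0 \<and> b $ 1 = 0 \<and> b $ 2 = 0
      then a $ 3 * b $ 3
      else a $ 1 * b $ 1 - a $ 2 * b $ 2)"

section \<open>First fundamental form and Laplace operator\<close>

definition surf_u :: "(real \<Rightarrow> real \<Rightarrow> real ^ 3) \<Rightarrow> real \<Rightarrow> real \<Rightarrow> real ^ 3" where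
  "surf_u r u v = vector_derivative (\<lambda>s. r s v) (at u)"

definition surf_v :: "(real \<Rightarrow> real \<Rightarrow> real ^ 3) \<Rightarrow> real \<Rightarrow> real \<Rightarrow> real ^ 3" where
  "surf_v r u v = vector_derivative (\<lambda>t. r u t) (at v)"

definition fff_E :: "(real \<Rightarrow> real \<Rightarrow> real ^ 3) \<Rightarrow> real \<Rightarrow> real \<Rightarrow> real" where
  "fff_E r u v = si_inner (surf_u r u v) (surf_u r u v)"

definition fff_F :: "(real \<Rightarrow> real \<Rightarrow> real ^ 3) \<Rightarrow> real \<Rightarrow> real \<Rightarrow> real" where
  "fff_F r u v = si_inner (surf_u r u v) (surf_v r u v)"

definition fff_G :: "(real \<Rightarrow> real \<Rightarrow> real ^ 3) \<Rightarrow> real \<Rightarrow> real \<Rightarrow> real" where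
  "fff_G r u v = si_inner (surf_v r u v) (surf_v r u v)"

definition fff_W :: "(real \<Rightarrow> real \<Rightarrow> real ^ 3) \<Rightarrow> real \<Rightarrow> real \<Rightarrow> real" where
  "fff_W r u v = fff_E r u v * fff_G r u v - (fff_F r u v)\<^sup>2"

definition partial_u :: "(real \<Rightarrow> real \<Rightarrow> real) \<Rightarrow> real \<Rightarrow> real \<Rightarrow> real" where
  "partial_u \<psi> u v = deriv (\<lambda>s. \<psi> s v) u"

definition partial_v :: "(real \<Rightarrow> real \<Rightarrow> real) \<Rightarrow> real \<Rightarrow> real \<Rightarrow> real" where
  "partial_v \<psi> u v = deriv (\<lambda>t. \<psi> u t) v"

definition laplace ::
  "(real \<Rightarrow> real \<Rightarrow> real ^ 3) \<Rightarrow> (real \<Rightarrow> real \<Rightarrow> real) \<Rightarrow> real \<Rightarrow> real \<Rightarrow> real" where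
  "laplace r \<psi> u v =
     - (1 / sqrt \<bar>fff_W r u v\<bar>) *
       (partial_u (\<lambda>s t. (fff_G r s t * partial_u \<psi> s t - fff_F r s t * partial_v \<psi> s t)
                           / sqrt \<bar>fff_W r s t\<bar>) u v
        - partial_v (\<lambda>s t. (fff_F r s t * partial_u \<psi> s t - fff_E r s t * partial_v \<psi> s t)
                             / sqrt \<bar>fff_W r s t\<bar>) u v)"

section \<open>Surfaces of revolution\<close>

definition generating_curve :: "(real \<Rightarrow> real) \<Rightarrow> real \<Rightarrow> real ^ 3" where
  "generating_curve f u = vector [0, u, f u]"

definition revolution_surface :: "(real \<Rightarrow> real) \<Rightarrow> real \<Rightarrow> real \<Rightarrow> real ^ 3" where
  "revolution_surface f u v = vector [u * sinh v, u * cosh v, f u]"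

text \<open>Intended for open \<open>S\<close>, where the two-sided iterated derivatives depend only on \<open>f\<close> on \<open>S\<close>.\<close>

definition smooth_on_open :: "real set \<Rightarrow> (real \<Rightarrow> real) \<Rightarrow> bool" where
  "smooth_on_open S f \<longleftrightarrow> (\<forall>n. \<forall>x\<in>S. (deriv ^^ n) f differentiable (at x))"

section \<open>Bessel functions of order zero\<close>

definition bessel_J0 :: "real \<Rightarrow> real" where
  "bessel_J0 x = (\<Sum>n. (-1) ^ n * x ^ (2 * n) / (2 ^ (2 * n) * (fact n)\<^sup>2))"

definition bessel_Y0 :: "real \<Rightarrow> real" where
  "bessel_Y0 x =
     2 / pi * ((ln (x / 2) + euler_mascheroni) * bessel_J0 x
               - (\<Sum>n. (-1) ^ n * harm n * x ^ (2 * n) / (2 ^ (2 * n) * (fact n)\<^sup>2)))"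

definition bessel_I0 :: "real \<Rightarrow> real" where
  "bessel_I0 x = (\<Sum>n. x ^ (2 * n) / (2 ^ (2 * n) * (fact n)\<^sup>2))"

definition bessel_K0 :: "real \<Rightarrow> real" where
  "bessel_K0 x =
     - (ln (x / 2) + euler_mascheroni) * bessel_I0 x
     + (\<Sum>n. harm n * x ^ (2 * n) / (2 ^ (2 * n) * (fact n)\<^sup>2))"

end

theory Submission
  imports Defs
begin

text \<open>
  For this surface \<open>E = -1\<close>, \<open>F = 0\<close> and \<open>G = u\<^sup>2\<close>, so
  \<open>\<Delta>\<psi> = -(1/u) ((u \<psi>\<^sub>u)\<^sub>u - (\<psi>\<^sub>v / u)\<^sub>v)\<close> (lemma \<open>laplace_revolution\<close>). The first two
  coordinates \<open>u sinh v\<close> and \<open>u cosh v\<close> are harmonic and do not vanish identically, which forces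
  \<open>\<lambda>\<^sub>1 = \<lambda>\<^sub>2 = 0\<close> and leaves \<open>\<lambda>\<^sub>3 \<noteq> 0\<close>. The third coordinate does not depend on \<open>v\<close>, and its equation is Bessel's
  equation of order zero in divergence form, \<open>(u f')' = -\<lambda>\<^sub>3 u f\<close>.

  Both signs of \<open>\<lambda>\<^sub>3\<close> are treated at once. The substitution \<open>t = \<mu> u\<^sup>2 / 4\<close> with \<open>\<mu> = -\<lambda>\<^sub>3\<close> turns
  \<open>(u y')' = \<mu> u y\<close> into \<open>(t y')' = y\<close>, where the derivative is now in \<open>t\<close>. The latter has the
  entire solution \<open>a(t) = \<Sum> t\<^sup>n / n!\<^sup>2\<close>. With \<open>H\<^sub>n\<close> the harmonic numbers, the series
  \<open>b(t) = \<Sum> H\<^sub>n t\<^sup>n / n!\<^sup>2\<close> satisfies \<open>(t b')' = b + a'\<close>, and the extra \<open>a'\<close> is what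
  is needed for \<open>ln u \<sqdot> a - b\<close> to be a second solution. For two solutions \<open>y\<close> and \<open>z\<close> the weighted
  Wronskian \<open>u (y z' - y' z)\<close> is constant. For the two above the logarithms cancel in it, so that
  its value \<open>1\<close> can be read off at the singular point \<open>t = 0\<close> (lemmas \<open>bessel_wronskian\<close> and
  \<open>radial_wronskian\<close>).

  The weighted Wronskians of \<open>f\<close> with the two solutions are constant too, because the domain of \<open>f\<close>
  is an interval. Cramer's rule with determinant \<open>1\<close>
  expresses \<open>f\<close> through the two solutions with these constants as coefficients
  (lemma \<open>radial_ode_solution\<close>). The functions \<open>J\<^sub>0, Y\<^sub>0\<close> for \<open>\<mu> < 0\<close> and \<open>I\<^sub>0, K\<^sub>0\<close> for
  \<open>\<mu> > 0\<close> differ from the two solutions by an invertible change of basis.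
\<close>

section \<open>Everywhere convergent power series\<close>

definition power_series_fun :: "(nat \<Rightarrow> real) \<Rightarrow> real \<Rightarrow> real" where
  "power_series_fun c t = (\<Sum>n. c n * t ^ n)"

lemma summable_power_series_if_le_inverse_fact:
  fixes c :: "nat \<Rightarrow> real"
  assumes "\<And>n. \<bar>c n\<bar> \<le> 1 / fact n"
  shows "summable (\<lambda>n. c n * t ^ n)"
proof (rule summable_comparison_test')
  show "summable (\<lambda>n. inverse (fact n) * \<bar>t\<bar> ^ n)"
    by (rule summable_exp)
  show "norm (c n * t ^ n) \<le> inverse (fact n) * \<bar>t\<bar> ^ n" for n
    using mult_right_mono[OF assms[of n], of "\<bar>t\<bar> ^ n"]
    by (simp add: abs_mult power_abs inverse_eq_divide)
qed

lemma DERIV_power_series_fun: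
  assumes "\<And>t. summable (\<lambda>n. c n * t ^ n)"
  shows "(power_series_fun c has_real_derivative power_series_fun (diffs c) t) (at t)"
  unfolding power_series_fun_def[abs_def]
  using termdiffs_strong_converges_everywhere[of c t] assms by simp

text \<open>The operator \<open>y \<mapsto> (t y')'\<close> multiplies the coefficient of \<open>t ^ Suc n\<close> by
  \<open>(Suc n)\<^sup>2\<close> and lowers its degree by one, so it acts on coefficients without mixing them.\<close>

lemma sums_bessel_operator:
  assumes "\<And>t. summable (\<lambda>n. c n * t ^ n)"
  shows "(\<lambda>n. (real (Suc n))\<^sup>2 * c (Suc n) * t ^ n) sums
    (power_series_fun (diffs c) t + t * power_series_fun (diffs (diffs c)) t)"
proof -
  have s1: "summable (\<lambda>n. diffs c n * t ^ n)" for t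
    by (rule termdiff_converges_all) (use assms in auto)
  have s2: "summable (\<lambda>n. diffs (diffs c) n * t ^ n)"
    by (rule termdiff_converges_all) (use s1 in auto)
  have "(\<lambda>n. t * (diffs (diffs c) n * t ^ n)) sums (t * power_series_fun (diffs (diffs c)) t)"
    unfolding power_series_fun_def by (intro sums_mult summable_sums s2)
  then have "(\<lambda>n. real (Suc n) * diffs c (Suc n) * t ^ Suc n) sums
      (t * power_series_fun (diffs (diffs c)) t)"
    by (simp add: diffs_def mult_ac)
  then have "(\<lambda>n. real n * diffs c n * t ^ n) sums (t * power_series_fun (diffs (diffs c)) t)"
    by (subst (asm) sums_Suc_iff) simp
  moreover have "(\<lambda>n. diffs c n * t ^ n) sums power_series_fun (diffs c) t"
    unfolding power_series_fun_def by (intro summable_sums s1)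
  ultimately have "(\<lambda>n. diffs c n * t ^ n + real n * diffs c n * t ^ n) sums
      (power_series_fun (diffs c) t + t * power_series_fun (diffs (diffs c)) t)"
    by (intro sums_add)
  then show ?thesis
    by (simp add: diffs_def power2_eq_square algebra_simps)
qed

section \<open>The two power series behind the Bessel functions of order zero\<close>

definition bessel_coeff :: "nat \<Rightarrow> real" where
  "bessel_coeff n = 1 / (fact n)\<^sup>2"

definition harm_bessel_coeff :: "nat \<Rightarrow> real" where
  "harm_bessel_coeff n = harm n / (fact n)\<^sup>2"

lemma summable_bessel_coeff: "summable (\<lambda>n. bessel_coeff n * t ^ n)"
proof (rule summable_power_series_if_le_inverse_fact)
  fix n
  have "(1 :: real) \<le> fact n" by simp
  then show "\<bar>bessel_coeff n\<bar> \<le> 1 / fact n"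
    by (simp add: bessel_coeff_def power2_eq_square divide_simps)
qed

lemma summable_harm_bessel_coeff: "summable (\<lambda>n. harm_bessel_coeff n * t ^ n)"
proof (rule summable_power_series_if_le_inverse_fact)
  fix n
  have "harm n \<le> (\<Sum>k = 1..n. 1 :: real)"
    unfolding harm_def by (intro sum_mono) (simp add: inverse_eq_divide)
  also have "\<dots> \<le> real (fact n)"
    by (simp only: sum_constant card_atLeastAtMost mult_1_right of_nat_le_iff)
      (simp add: fact_ge_self)
  finally have "harm n \<le> (fact n :: real)" by simp
  then show "\<bar>harm_bessel_coeff n\<bar> \<le> 1 / fact n"
    by (simp add: harm_bessel_coeff_def power2_eq_square harm_nonneg divide_simps)
qed

abbreviation bessel_ser :: "real \<Rightarrow> real" where
  "bessel_ser \<equiv> power_series_fun bessel_coeff"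
abbreviation bessel_ser' :: "real \<Rightarrow> real" where
  "bessel_ser' \<equiv> power_series_fun (diffs bessel_coeff)"
abbreviation bessel_ser'' :: "real \<Rightarrow> real" where
  "bessel_ser'' \<equiv> power_series_fun (diffs (diffs bessel_coeff))"
abbreviation harm_ser :: "real \<Rightarrow> real" where
  "harm_ser \<equiv> power_series_fun harm_bessel_coeff"
abbreviation harm_ser' :: "real \<Rightarrow> real" where
  "harm_ser' \<equiv> power_series_fun (diffs harm_bessel_coeff)"
abbreviation harm_ser'' :: "real \<Rightarrow> real" where
  "harm_ser'' \<equiv> power_series_fun (diffs (diffs harm_bessel_coeff))"

lemma DERIV_bessel_series:
  "(bessel_ser has_real_derivative bessel_ser' t) (at t)"
  "(bessel_ser' has_real_derivative bessel_ser'' t) (at t)"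
  "(harm_ser has_real_derivative harm_ser' t) (at t)"
  "(harm_ser' has_real_derivative harm_ser'' t) (at t)"
  by (intro DERIV_power_series_fun termdiff_converges_all
      summable_bessel_coeff summable_harm_bessel_coeff)+

lemma bessel_ser_ode: "bessel_ser' t + t * bessel_ser'' t = bessel_ser t"
proof -
  have "(real (Suc n))\<^sup>2 * bessel_coeff (Suc n) = bessel_coeff n" for n
    by (simp add: bessel_coeff_def power_mult_distrib del: of_nat_Suc)
  then have "(\<lambda>n. bessel_coeff n * t ^ n) sums (bessel_ser' t + t * bessel_ser'' t)"
    using sums_bessel_operator[of bessel_coeff t] summable_bessel_coeff by simp
  then show ?thesis
    unfolding power_series_fun_def[of bessel_coeff] by (simp add: sums_iff)
qed

text \<open>The recursion \<open>harm (Suc n) = harm n + 1 / (n + 1)\<close> splits the coefficients into those of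
  the series itself and \<open>1 / (n! (n + 1)!)\<close>, the coefficients of \<open>bessel_ser'\<close>.\<close>

lemma harm_ser_ode: "harm_ser' t + t * harm_ser'' t = harm_ser t + bessel_ser' t"
proof -
  have coeff: "(real (Suc n))\<^sup>2 * harm_bessel_coeff (Suc n)
      = harm_bessel_coeff n + diffs bessel_coeff n" for n
    by (simp add: harm_bessel_coeff_def bessel_coeff_def diffs_def harm_Suc power_mult_distrib
        power2_eq_square divide_simps del: of_nat_Suc)
  have "(\<lambda>n. (harm_bessel_coeff n + diffs bessel_coeff n) * t ^ n) sums
      (harm_ser' t + t * harm_ser'' t)"
    using sums_bessel_operator[of harm_bessel_coeff t] summable_harm_bessel_coeff
    by (simp only: coeff)
  moreover have "(\<lambda>n. harm_bessel_coeff n * t ^ n + diffs bessel_coeff n * t ^ n) sums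
      (harm_ser t + bessel_ser' t)"
    unfolding power_series_fun_def
    by (intro sums_add summable_sums summable_harm_bessel_coeff termdiff_converges_all
        summable_bessel_coeff)
  ultimately show ?thesis
    by (simp add: distrib_right sums_iff)
qed

text \<open>This expression is \<open>t\<close> times the Wronskian of the two solutions of \<open>(t y')' = y\<close>,
  \<open>bessel_ser\<close> and \<open>ln t * bessel_ser t - 2 * harm_ser t\<close>; the logarithms cancel in it, so it is
  smooth at the singular point \<open>t = 0\<close> and can be evaluated there.\<close>

lemma bessel_wronskian:
  "(bessel_ser t)\<^sup>2 + 2 * t * (bessel_ser' t * harm_ser t - bessel_ser t * harm_ser' t) = 1"
proof -
  let ?q = "\<lambda>t. (bessel_ser t)\<^sup>2
    + 2 * t * (bessel_ser' t * harm_ser t - bessel_ser t * harm_ser' t)"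
  have "(?q has_real_derivative 0) (at x)" for x
  proof -
    have "(?q has_real_derivative
        (2 * bessel_ser x * bessel_ser' x
         + 2 * harm_ser x * (bessel_ser' x + x * bessel_ser'' x)
         - 2 * bessel_ser x * (harm_ser' x + x * harm_ser'' x))) (at x)"
      by (auto intro!: derivative_eq_intros DERIV_bessel_series simp: algebra_simps)
    then show ?thesis
      by (simp add: bessel_ser_ode harm_ser_ode algebra_simps)
  qed
  then have "?q t = ?q 0"
    by (intro DERIV_isconst_all) auto
  moreover have "bessel_ser 0 = 1"
    unfolding power_series_fun_def powser_zero by (simp add: bessel_coeff_def)
  ultimately show ?thesis
    by simp
qed

section \<open>Solutions of the radial equation\<close>

text \<open>A fundamental system of \<open>(u y')' = \<mu> u y\<close> on \<open>u > 0\<close>. Each solution comes with its flux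
  \<open>u y'\<close>, which turns the second order equation into the first order system \<open>radial_ode\<close>.\<close>

definition radial_sol1 :: "real \<Rightarrow> real \<Rightarrow> real" where
  "radial_sol1 \<mu> u = bessel_ser (\<mu> * u\<^sup>2 / 4)"

definition radial_flux1 :: "real \<Rightarrow> real \<Rightarrow> real" where
  "radial_flux1 \<mu> u = \<mu> * u\<^sup>2 / 2 * bessel_ser' (\<mu> * u\<^sup>2 / 4)"

definition radial_sol2 :: "real \<Rightarrow> real \<Rightarrow> real" where
  "radial_sol2 \<mu> u = ln u * bessel_ser (\<mu> * u\<^sup>2 / 4) - harm_ser (\<mu> * u\<^sup>2 / 4)"

definition radial_flux2 :: "real \<Rightarrow> real \<Rightarrow> real" where
  "radial_flux2 \<mu> u = bessel_ser (\<mu> * u\<^sup>2 / 4)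
    + \<mu> * u\<^sup>2 / 2 * (ln u * bessel_ser' (\<mu> * u\<^sup>2 / 4) - harm_ser' (\<mu> * u\<^sup>2 / 4))"

definition radial_ode :: "real \<Rightarrow> real set \<Rightarrow> (real \<Rightarrow> real) \<Rightarrow> (real \<Rightarrow> real) \<Rightarrow> bool" where
  "radial_ode \<mu> S y p \<longleftrightarrow> (\<forall>u\<in>S. (y has_real_derivative p u / u) (at u) \<and>
     (p has_real_derivative \<mu> * u * y u) (at u))"

lemma DERIV_radial_parts:
  fixes \<mu> u :: real
  shows "((\<lambda>u. \<mu> * u\<^sup>2 / 2) has_real_derivative \<mu> * u) (at u)"
    and "((\<lambda>u. bessel_ser (\<mu> * u\<^sup>2 / 4)) has_real_derivative
      bessel_ser' (\<mu> * u\<^sup>2 / 4) * (\<mu> * u / 2)) (at u)"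
    and "((\<lambda>u. bessel_ser' (\<mu> * u\<^sup>2 / 4)) has_real_derivative
      bessel_ser'' (\<mu> * u\<^sup>2 / 4) * (\<mu> * u / 2)) (at u)"
    and "((\<lambda>u. harm_ser (\<mu> * u\<^sup>2 / 4)) has_real_derivative
      harm_ser' (\<mu> * u\<^sup>2 / 4) * (\<mu> * u / 2)) (at u)"
    and "((\<lambda>u. harm_ser' (\<mu> * u\<^sup>2 / 4)) has_real_derivative
      harm_ser'' (\<mu> * u\<^sup>2 / 4) * (\<mu> * u / 2)) (at u)"
proof -
  have "((\<lambda>u. \<mu> * u\<^sup>2 / 4) has_real_derivative \<mu> * u / 2) (at u)"
    by (auto intro!: derivative_eq_intros)
  note chain = DERIV_bessel_series[THEN DERIV_chain2, OF this]
  show "((\<lambda>u. \<mu> * u\<^sup>2 / 2) has_real_derivative \<mu> * u) (at u)"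
    by (auto intro!: derivative_eq_intros)
  show "((\<lambda>u. bessel_ser (\<mu> * u\<^sup>2 / 4)) has_real_derivative
      bessel_ser' (\<mu> * u\<^sup>2 / 4) * (\<mu> * u / 2)) (at u)"
    by (rule chain)
  show "((\<lambda>u. bessel_ser' (\<mu> * u\<^sup>2 / 4)) has_real_derivative
      bessel_ser'' (\<mu> * u\<^sup>2 / 4) * (\<mu> * u / 2)) (at u)"
    by (rule chain)
  show "((\<lambda>u. harm_ser (\<mu> * u\<^sup>2 / 4)) has_real_derivative
      harm_ser' (\<mu> * u\<^sup>2 / 4) * (\<mu> * u / 2)) (at u)"
    by (rule chain)
  show "((\<lambda>u. harm_ser' (\<mu> * u\<^sup>2 / 4)) has_real_derivative
      harm_ser'' (\<mu> * u\<^sup>2 / 4) * (\<mu> * u / 2)) (at u)"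
    by (rule chain)
qed

lemma radial_ode_sol1:
  assumes "S \<subseteq> {0<..}"
  shows "radial_ode \<mu> S (radial_sol1 \<mu>) (radial_flux1 \<mu>)"
  unfolding radial_ode_def
proof (intro ballI conjI)
  fix u assume "u \<in> S"
  then have u: "u > 0" using assms by auto
  let ?t = "\<mu> * u\<^sup>2 / 4"
  show "(radial_sol1 \<mu> has_real_derivative radial_flux1 \<mu> u / u) (at u)"
    unfolding radial_sol1_def[abs_def] radial_flux1_def
    by (rule DERIV_cong[OF DERIV_radial_parts(2)]) (use u in \<open>simp add: power2_eq_square\<close>)
  have "(radial_flux1 \<mu> has_real_derivative
      \<mu> * u * (bessel_ser' ?t + ?t * bessel_ser'' ?t)) (at u)"
    unfolding radial_flux1_def[abs_def]
    by (rule DERIV_cong[OF DERIV_mult[OF DERIV_radial_parts(1,3)]])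
      (simp add: algebra_simps power2_eq_square)
  then show "(radial_flux1 \<mu> has_real_derivative \<mu> * u * radial_sol1 \<mu> u) (at u)"
    by (simp only: bessel_ser_ode radial_sol1_def)
qed

lemma radial_ode_sol2:
  assumes "S \<subseteq> {0<..}"
  shows "radial_ode \<mu> S (radial_sol2 \<mu>) (radial_flux2 \<mu>)"
  unfolding radial_ode_def
proof (intro ballI conjI)
  fix u assume "u \<in> S"
  then have u: "u > 0" using assms by auto
  let ?t = "\<mu> * u\<^sup>2 / 4"
  note deriv_rules = DERIV_radial_parts DERIV_ln[OF u] DERIV_add DERIV_diff DERIV_mult
  have "((\<lambda>u. ln u * bessel_ser (\<mu> * u\<^sup>2 / 4) - harm_ser (\<mu> * u\<^sup>2 / 4)) has_real_derivative
      inverse u * bessel_ser ?t + bessel_ser' ?t * (\<mu> * u / 2) * ln u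
        - harm_ser' ?t * (\<mu> * u / 2)) (at u)"
    by (rule deriv_rules)+
  moreover have "radial_flux2 \<mu> u / u = inverse u * bessel_ser ?t
      + bessel_ser' ?t * (\<mu> * u / 2) * ln u - harm_ser' ?t * (\<mu> * u / 2)"
    using u by (simp add: radial_flux2_def inverse_eq_divide add_divide_distrib
        right_diff_distrib diff_divide_distrib power2_eq_square mult_ac)
  ultimately show "(radial_sol2 \<mu> has_real_derivative radial_flux2 \<mu> u / u) (at u)"
    unfolding radial_sol2_def[abs_def] by simp
  have "((\<lambda>u. bessel_ser (\<mu> * u\<^sup>2 / 4)
      + \<mu> * u\<^sup>2 / 2 * (ln u * bessel_ser' (\<mu> * u\<^sup>2 / 4) - harm_ser' (\<mu> * u\<^sup>2 / 4))) has_real_derivative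
      bessel_ser' ?t * (\<mu> * u / 2) + (\<mu> * u * (ln u * bessel_ser' ?t - harm_ser' ?t)
        + (inverse u * bessel_ser' ?t + bessel_ser'' ?t * (\<mu> * u / 2) * ln u
            - harm_ser'' ?t * (\<mu> * u / 2)) * (\<mu> * u\<^sup>2 / 2))) (at u)"
    by (rule deriv_rules)+
  also have "bessel_ser' ?t * (\<mu> * u / 2) + (\<mu> * u * (ln u * bessel_ser' ?t - harm_ser' ?t)
        + (inverse u * bessel_ser' ?t + bessel_ser'' ?t * (\<mu> * u / 2) * ln u
            - harm_ser'' ?t * (\<mu> * u / 2)) * (\<mu> * u\<^sup>2 / 2))
      = \<mu> * u * (bessel_ser' ?t + ln u * (bessel_ser' ?t + ?t * bessel_ser'' ?t)
        - (harm_ser' ?t + ?t * harm_ser'' ?t))"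
    using u by (simp add: inverse_eq_divide power2_eq_square algebra_simps)
  also have "\<dots> = \<mu> * u * radial_sol2 \<mu> u"
    by (simp only: bessel_ser_ode harm_ser_ode radial_sol2_def) simp
  finally show "(radial_flux2 \<mu> has_real_derivative \<mu> * u * radial_sol2 \<mu> u) (at u)"
    unfolding radial_flux2_def[abs_def] .
qed

lemma radial_wronskian:
  "radial_sol1 \<mu> u * radial_flux2 \<mu> u - radial_flux1 \<mu> u * radial_sol2 \<mu> u = 1"
  using bessel_wronskian[of "\<mu> * u\<^sup>2 / 4"]
  unfolding radial_sol1_def radial_sol2_def radial_flux1_def radial_flux2_def
  by (simp add: algebra_simps power2_eq_square)

text \<open>Lagrange's identity: in the derivative, \<open>y' q\<close> cancels \<open>p z'\<close> since both equal \<open>p q / u\<close>,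
  and \<open>y q'\<close> cancels \<open>p' z\<close> since both equal \<open>\<mu> u y z\<close>.\<close>

lemma radial_wronskian_constant:
  assumes "convex S" and "radial_ode \<mu> S y p" and "radial_ode \<mu> S z q"
  shows "\<exists>k. \<forall>u\<in>S. y u * q u - p u * z u = k"
proof -
  have "((\<lambda>u. y u * q u - p u * z u) has_real_derivative 0) (at u within S)" if "u \<in> S" for u
  proof -
    have "((\<lambda>u. y u * q u - p u * z u) has_real_derivative
        (p u / u * q u + \<mu> * u * z u * y u - (\<mu> * u * y u * z u + q u / u * p u))) (at u)"
      using assms(2,3) that unfolding radial_ode_def by (intro DERIV_diff DERIV_mult) auto
    then have "((\<lambda>u. y u * q u - p u * z u) has_real_derivative 0) (at u)"
      by (simp add: mult_ac)
    then show ?thesis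
      by (rule has_field_derivative_at_within)
  qed
  then have "(\<lambda>u. y u * q u - p u * z u) constant_on S"
    using has_field_derivative_zero_constant[OF assms(1)] unfolding constant_on_def by blast
  then show ?thesis unfolding constant_on_def by blast
qed

text \<open>The coefficients are the constant weighted Wronskians of \<open>f\<close> with the two solutions. Cramer's rule
  recovers \<open>f\<close> from them without division because the determinant is \<open>1\<close>.\<close>

lemma radial_ode_solution:
  assumes "S \<subseteq> {0<..}" and "convex S" and f: "radial_ode \<mu> S f p"
  shows "\<exists>k1 k2. \<forall>u\<in>S. f u = k1 * radial_sol1 \<mu> u + k2 * radial_sol2 \<mu> u"
proof -
  obtain k1 where k1: "\<forall>u\<in>S. f u * radial_flux2 \<mu> u - p u * radial_sol2 \<mu> u = k1"
    using radial_wronskian_constant[OF assms(2) f radial_ode_sol2[OF assms(1)]] by blast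
  obtain k2 where k2: "\<forall>u\<in>S. radial_sol1 \<mu> u * p u - radial_flux1 \<mu> u * f u = k2"
    using radial_wronskian_constant[OF assms(2) radial_ode_sol1[OF assms(1)] f] by blast
  have "f u = k1 * radial_sol1 \<mu> u + k2 * radial_sol2 \<mu> u" if "u \<in> S" for u
  proof -
    have "f u = f u * (radial_sol1 \<mu> u * radial_flux2 \<mu> u - radial_flux1 \<mu> u * radial_sol2 \<mu> u)"
      by (simp add: radial_wronskian)
    also have "\<dots> = (f u * radial_flux2 \<mu> u - p u * radial_sol2 \<mu> u) * radial_sol1 \<mu> u
        + (radial_sol1 \<mu> u * p u - radial_flux1 \<mu> u * f u) * radial_sol2 \<mu> u"
      by (simp add: algebra_simps)
    finally show ?thesis using k1 k2 that by simp
  qed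
  then show ?thesis by blast
qed

section \<open>Identification with the Bessel functions\<close>

text \<open>The sign \<open>e\<close> is \<open>-1\<close> for \<open>J\<^sub>0, Y\<^sub>0\<close> and \<open>1\<close> for \<open>I\<^sub>0, K\<^sub>0\<close>; absorbing it into the
  argument gives the parameter \<open>\<mu> = e l\<close> of the radial equation.\<close>

lemma bessel_term_rescale:
  fixes c d e l u :: real
  assumes "l > 0"
  shows "e ^ n * c * (sqrt l * u) ^ (2 * n) / (2 ^ (2 * n) * d) = c / d * (e * l * u\<^sup>2 / 4) ^ n"
proof -
  have "(sqrt l * u) ^ (2 * n) = l ^ n * (u\<^sup>2) ^ n"
    using assms by (simp add: power_mult power_mult_distrib)
  moreover have "(2 :: real) ^ (2 * n) = 4 ^ n"
    by (simp add: power_mult)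
  ultimately show ?thesis
    by (simp only:) (simp add: power_mult_distrib power_divide mult_ac)
qed

lemma bessel_J0_eq_radial_sol1:
  assumes "l > 0"
  shows "bessel_J0 (sqrt l * u) = radial_sol1 (- l) u"
  using bessel_term_rescale[OF assms, of "-1" _ 1]
  unfolding bessel_J0_def radial_sol1_def power_series_fun_def bessel_coeff_def by simp

lemma bessel_I0_eq_radial_sol1:
  assumes "m > 0"
  shows "bessel_I0 (sqrt m * u) = radial_sol1 m u"
  using bessel_term_rescale[OF assms, of 1 _ 1]
  unfolding bessel_I0_def radial_sol1_def power_series_fun_def bessel_coeff_def by simp

lemma ln_sqrt_mult_half:
  assumes "m > 0" and "u > 0"
  shows "ln (sqrt m * u / 2) = ln u + ln (sqrt m / 2)"
proof -
  have "sqrt m * u / 2 = u * (sqrt m / 2)" by simp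
  then show ?thesis
    using assms ln_mult_pos[of u "sqrt m / 2"] by (simp only:) simp
qed

text \<open>The multiple of the first solution comes from \<open>ln (sqrt l u / 2) = ln u + ln (sqrt l / 2)\<close> and
  the Euler-Mascheroni constant.\<close>

lemma bessel_Y0_eq_radial_sols:
  assumes "l > 0" and "u > 0"
  shows "bessel_Y0 (sqrt l * u) = 2 / pi *
    (radial_sol2 (- l) u + (ln (sqrt l / 2) + euler_mascheroni) * radial_sol1 (- l) u)"
proof -
  have "(\<Sum>n. (-1) ^ n * harm n * (sqrt l * u) ^ (2 * n) / (2 ^ (2 * n) * (fact n)\<^sup>2))
      = harm_ser (- l * u\<^sup>2 / 4)"
    unfolding bessel_term_rescale[OF assms(1)] power_series_fun_def harm_bessel_coeff_def by simp
  then show ?thesis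
    unfolding bessel_Y0_def bessel_J0_eq_radial_sol1[OF assms(1)] ln_sqrt_mult_half[OF assms]
    by (simp add: radial_sol2_def radial_sol1_def algebra_simps)
qed

lemma bessel_K0_eq_radial_sols:
  assumes "m > 0" and "u > 0"
  shows "bessel_K0 (sqrt m * u) =
    - radial_sol2 m u - (ln (sqrt m / 2) + euler_mascheroni) * radial_sol1 m u"
proof -
  have "(\<Sum>n. harm n * (sqrt m * u) ^ (2 * n) / (2 ^ (2 * n) * (fact n)\<^sup>2))
      = harm_ser (m * u\<^sup>2 / 4)"
    using bessel_term_rescale[OF assms(1), of 1]
    unfolding power_series_fun_def harm_bessel_coeff_def by simp
  then show ?thesis
    unfolding bessel_K0_def bessel_I0_eq_radial_sol1[OF assms(1)] ln_sqrt_mult_half[OF assms]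
    by (simp add: radial_sol2_def radial_sol1_def algebra_simps)
qed

lemma radial_ode_solution_bessel_JY:
  assumes S: "S \<subseteq> {0<..}" "convex S" and f: "radial_ode (- l) S f p" and l: "l > 0"
  shows "\<exists>c1 c2. \<forall>u\<in>S. f u = c1 * bessel_J0 (sqrt l * u) + c2 * bessel_Y0 (sqrt l * u)"
proof -
  obtain k1 k2 where k: "\<forall>u\<in>S. f u = k1 * radial_sol1 (- l) u + k2 * radial_sol2 (- l) u"
    using radial_ode_solution[OF S f] by blast
  let ?\<kappa> = "ln (sqrt l / 2) + euler_mascheroni"
  have "f u = (k1 - k2 * ?\<kappa>) * bessel_J0 (sqrt l * u) + k2 * pi / 2 * bessel_Y0 (sqrt l * u)"
    if "u \<in> S" for u
  proof -
    have "u > 0" using that S by auto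
    then show ?thesis
      using k that unfolding bessel_J0_eq_radial_sol1[OF l] bessel_Y0_eq_radial_sols[OF l \<open>u > 0\<close>]
      by (simp add: algebra_simps)
  qed
  then show ?thesis by blast
qed

lemma radial_ode_solution_bessel_IK:
  assumes S: "S \<subseteq> {0<..}" "convex S" and f: "radial_ode m S f p" and m: "m > 0"
  shows "\<exists>c1 c2. \<forall>u\<in>S. f u = c1 * bessel_I0 (sqrt m * u) + c2 * bessel_K0 (sqrt m * u)"
proof -
  obtain k1 k2 where k: "\<forall>u\<in>S. f u = k1 * radial_sol1 m u + k2 * radial_sol2 m u"
    using radial_ode_solution[OF S f] by blast
  let ?\<kappa> = "ln (sqrt m / 2) + euler_mascheroni"
  have "f u = (k1 - k2 * ?\<kappa>) * bessel_I0 (sqrt m * u) + (- k2) * bessel_K0 (sqrt m * u)"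
    if "u \<in> S" for u
  proof -
    have "u > 0" using that S by auto
    then show ?thesis
      using k that unfolding bessel_I0_eq_radial_sol1[OF m] bessel_K0_eq_radial_sols[OF m \<open>u > 0\<close>]
      by (simp add: algebra_simps)
  qed
  then show ?thesis by blast
qed

section \<open>The Laplace operator of a surface of revolution\<close>

lemma has_vector_derivative_vec3:
  fixes g :: "real \<Rightarrow> real ^ 3"
  assumes "\<And>i. ((\<lambda>x. g x $ i) has_real_derivative d $ i) (at x)"
  shows "(g has_vector_derivative d) (at x)"
  using assms
  by (simp add: has_vector_derivative_def has_derivative_componentwise_within[of g]
      Basis_vec_def inner_axis has_field_derivative_def mult_commute_abs)

lemma surf_u_revolution:
  assumes "f differentiable (at u)"
  shows "surf_u (revolution_surface f) u v = vector [sinh v, cosh v, deriv f u]"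
  unfolding surf_u_def
proof (intro vector_derivative_at has_vector_derivative_vec3)
  fix i :: 3
  have "(f has_real_derivative deriv f u) (at u)"
    using assms by (simp add: DERIV_deriv_iff_real_differentiable)
  then show "((\<lambda>s. revolution_surface f s v $ i) has_real_derivative
      vector [sinh v, cosh v, deriv f u] $ i) (at u)"
    using exhaust_3[of i]
    by (auto simp: revolution_surface_def intro!: derivative_eq_intros)
qed

lemma surf_v_revolution:
  "surf_v (revolution_surface f) u v = vector [u * cosh v, u * sinh v, 0]"
  unfolding surf_v_def
proof (intro vector_derivative_at has_vector_derivative_vec3)
  fix i :: 3
  show "((\<lambda>t. revolution_surface f u t $ i) has_real_derivative
      vector [u * cosh v, u * sinh v, 0] $ i) (at v)"
    using exhaust_3[of i]
    by (auto simp: revolution_surface_def intro!: derivative_eq_intros)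
qed

lemma cosh_sinh_mult_diff: "cosh v * cosh v - sinh v * sinh v = (1 :: real)"
  using hyperbolic_pythagoras[of v] by (simp add: power2_eq_square)

lemma cosh_neq_0: "cosh v \<noteq> (0 :: real)"
  using cosh_real_pos[of v] by simp

lemma fff_revolution:
  assumes "f differentiable (at u)" and "u > 0"
  shows "fff_E (revolution_surface f) u v = -1"
    and "fff_F (revolution_surface f) u v = 0"
    and "fff_G (revolution_surface f) u v = u\<^sup>2"
    and "fff_W (revolution_surface f) u v = - u\<^sup>2"
proof -
  have "u * cosh v * (u * cosh v) - u * sinh v * (u * sinh v)
      = u\<^sup>2 * (cosh v * cosh v - sinh v * sinh v)"
    by (simp add: power2_eq_square algebra_simps)
  then have v: "u * cosh v * (u * cosh v) - u * sinh v * (u * sinh v) = u\<^sup>2"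
    by (simp only: cosh_sinh_mult_diff mult_1_right)
  show E: "fff_E (revolution_surface f) u v = -1"
    using cosh_sinh_mult_diff[of v] cosh_neq_0[of v]
    by (simp add: fff_E_def surf_u_revolution[OF assms(1)] si_inner_def)
  show F: "fff_F (revolution_surface f) u v = 0"
    using cosh_neq_0[of v]
    by (simp add: fff_F_def surf_u_revolution[OF assms(1)] surf_v_revolution si_inner_def)
  show G: "fff_G (revolution_surface f) u v = u\<^sup>2"
    using cosh_neq_0[of v] assms(2) v
    by (simp add: fff_G_def surf_v_revolution si_inner_def)
  show "fff_W (revolution_surface f) u v = - u\<^sup>2"
    by (simp add: fff_W_def E F G)
qed

text \<open>The metric coefficients inside the outer \<open>u\<close>-derivative are known only at parameters in \<open>I\<close>;
  openness of \<open>I\<close> makes this a neighbourhood of \<open>u\<close>, which determines the derivative.\<close>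

lemma laplace_revolution:
  assumes "open I" and I: "I \<subseteq> {0<..}" and f: "\<And>s. s \<in> I \<Longrightarrow> f differentiable (at s)"
    and u: "u \<in> I"
  shows "laplace (revolution_surface f) \<psi> u v =
    - (1 / u) * (deriv (\<lambda>s. s * partial_u \<psi> s v) u - deriv (\<lambda>t. partial_v \<psi> u t / u) v)"
proof -
  let ?r = "revolution_surface f"
  have pos: "s > 0" if "s \<in> I" for s using that I by auto
  note fff = fff_revolution[OF f pos]
  have "\<forall>\<^sub>F s in nhds u. s \<in> I"
    using assms(1) u by (rule eventually_nhds_in_open)
  then have "\<forall>\<^sub>F s in nhds u. (fff_G ?r s v * partial_u \<psi> s v - fff_F ?r s v * partial_v \<psi> s v)
      / sqrt \<bar>fff_W ?r s v\<bar> = s * partial_u \<psi> s v"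
  proof eventually_elim
    case (elim s)
    then show ?case
      using pos[OF elim] by (simp add: fff power2_eq_square)
  qed
  then have "deriv (\<lambda>s. (fff_G ?r s v * partial_u \<psi> s v - fff_F ?r s v * partial_v \<psi> s v)
      / sqrt \<bar>fff_W ?r s v\<bar>) u = deriv (\<lambda>s. s * partial_u \<psi> s v) u"
    by (intro deriv_cong_ev refl)
  then have u_part: "partial_u (\<lambda>s t. (fff_G ?r s t * partial_u \<psi> s t - fff_F ?r s t * partial_v \<psi> s t)
      / sqrt \<bar>fff_W ?r s t\<bar>) u v = deriv (\<lambda>s. s * partial_u \<psi> s v) u"
    by (subst partial_u_def)
  have "(\<lambda>t. (fff_F ?r u t * partial_u \<psi> u t - fff_E ?r u t * partial_v \<psi> u t)
      / sqrt \<bar>fff_W ?r u t\<bar>) = (\<lambda>t. partial_v \<psi> u t / u)"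
    using pos[OF u] by (simp add: fff u)
  then have v_part: "partial_v (\<lambda>s t. (fff_F ?r s t * partial_u \<psi> s t - fff_E ?r s t * partial_v \<psi> s t)
      / sqrt \<bar>fff_W ?r s t\<bar>) u v = deriv (\<lambda>t. partial_v \<psi> u t / u) v"
    by (subst partial_v_def) simp
  show ?thesis
    using pos[OF u] unfolding laplace_def u_part v_part by (simp add: fff u)
qed

lemma laplace_revolution_component_1:
  assumes "open I" and "I \<subseteq> {0<..}" and "\<And>s. s \<in> I \<Longrightarrow> f differentiable (at s)" and "u \<in> I"
  shows "laplace (revolution_surface f) (\<lambda>s t. revolution_surface f s t $ 1) u v = 0"
proof -
  have "partial_u (\<lambda>s t. revolution_surface f s t $ 1) = (\<lambda>s t. sinh t)"
    unfolding partial_u_def revolution_surface_def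
    by (intro ext DERIV_imp_deriv) (auto intro!: derivative_eq_intros)
  moreover have "partial_v (\<lambda>s t. revolution_surface f s t $ 1) = (\<lambda>s t. s * cosh t)"
    unfolding partial_v_def revolution_surface_def
    by (intro ext DERIV_imp_deriv) (auto intro!: derivative_eq_intros)
  moreover have "deriv (\<lambda>s. s * sinh v) u = sinh v"
    by (intro DERIV_imp_deriv) (auto intro!: derivative_eq_intros)
  moreover have "u \<noteq> 0"
    using assms(2,4) by auto
  then have "deriv (\<lambda>t. u * cosh t / u) v = sinh v"
    by (intro DERIV_imp_deriv) (auto intro!: derivative_eq_intros)
  ultimately show ?thesis
    by (simp add: laplace_revolution[OF assms] del: times_divide_eq_left)
qed

lemma laplace_revolution_component_2:
  assumes "open I" and "I \<subseteq> {0<..}" and "\<And>s. s \<in> I \<Longrightarrow> f differentiable (at s)" and "u \<in> I"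
  shows "laplace (revolution_surface f) (\<lambda>s t. revolution_surface f s t $ 2) u v = 0"
proof -
  have "partial_u (\<lambda>s t. revolution_surface f s t $ 2) = (\<lambda>s t. cosh t)"
    unfolding partial_u_def revolution_surface_def
    by (intro ext DERIV_imp_deriv) (auto intro!: derivative_eq_intros)
  moreover have "partial_v (\<lambda>s t. revolution_surface f s t $ 2) = (\<lambda>s t. s * sinh t)"
    unfolding partial_v_def revolution_surface_def
    by (intro ext DERIV_imp_deriv) (auto intro!: derivative_eq_intros)
  moreover have "deriv (\<lambda>s. s * cosh v) u = cosh v"
    by (intro DERIV_imp_deriv) (auto intro!: derivative_eq_intros)
  moreover have "u \<noteq> 0"
    using assms(2,4) by auto
  then have "deriv (\<lambda>t. u * sinh t / u) v = cosh v"
    by (intro DERIV_imp_deriv) (auto intro!: derivative_eq_intros)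
  ultimately show ?thesis
    by (simp add: laplace_revolution[OF assms] del: times_divide_eq_left)
qed

lemma laplace_revolution_component_3:
  assumes "open I" and "I \<subseteq> {0<..}" and "\<And>s. s \<in> I \<Longrightarrow> f differentiable (at s)" and "u \<in> I"
  shows "laplace (revolution_surface f) (\<lambda>s t. revolution_surface f s t $ 3) u v =
    - (1 / u) * deriv (\<lambda>s. s * deriv f s) u"
proof -
  have "partial_u (\<lambda>s t. revolution_surface f s t $ 3) = (\<lambda>s t. deriv f s)"
    unfolding partial_u_def revolution_surface_def by simp
  moreover have "partial_v (\<lambda>s t. revolution_surface f s t $ 3) = (\<lambda>s t. 0)"
    unfolding partial_v_def revolution_surface_def by simp
  ultimately show ?thesis
    by (simp add: laplace_revolution[OF assms])
qed

lemma radial_ode_generating_function: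
  assumes "open I" and I: "I \<subseteq> {0<..}" and f: "smooth_on_open I f"
    and laplace: "\<And>u v. u \<in> I \<Longrightarrow>
      laplace (revolution_surface f) (\<lambda>s t. revolution_surface f s t $ 3) u v
        = l * revolution_surface f u v $ 3"
  shows "radial_ode (- l) I f (\<lambda>u. u * deriv f u)"
  unfolding radial_ode_def
proof (intro ballI conjI)
  fix u assume u: "u \<in> I"
  then have pos: "u > 0" using I by auto
  have f0: "f differentiable (at s)" if "s \<in> I" for s
    using f[unfolded smooth_on_open_def, rule_format, of s 0] that by simp
  show "(f has_real_derivative u * deriv f u / u) (at u)"
    using f0[OF u] pos by (simp add: DERIV_deriv_iff_real_differentiable)
  have "deriv f differentiable (at u)"
    using f[unfolded smooth_on_open_def, rule_format, of u 1] u by simp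
  then have "(\<lambda>s. s * deriv f s) differentiable (at u)"
    by (intro differentiable_mult) auto
  then have "((\<lambda>s. s * deriv f s) has_real_derivative deriv (\<lambda>s. s * deriv f s) u) (at u)"
    by (simp add: DERIV_deriv_iff_real_differentiable)
  moreover have "- (1 / u) * deriv (\<lambda>s. s * deriv f s) u = l * f u"
    using laplace[OF u, of 0] laplace_revolution_component_3[OF assms(1) I f0 u, of 0]
    by (simp add: revolution_surface_def)
  then have "deriv (\<lambda>s. s * deriv f s) u = - l * u * f u"
    using pos by (simp add: field_simps)
  ultimately show "((\<lambda>s. s * deriv f s) has_real_derivative - l * u * f u) (at u)"
    by simp
qed

section \<open>Surfaces of revolution whose coordinates are eigenfunctions\<close>

theorem theorem4p2:
  fixes I :: "real set" and f :: "real \<Rightarrow> real" and l1 l2 l3 :: real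
  assumes "open I" and "is_interval I" and "I \<noteq> {}" and "I \<subseteq> {0<..}"
    and "smooth_on_open I f"
    and "\<And>u v. u \<in> I \<Longrightarrow>
           laplace (revolution_surface f) (\<lambda>s t. revolution_surface f s t $ 1) u v
             = l1 * revolution_surface f u v $ 1"
    and "\<And>u v. u \<in> I \<Longrightarrow>
           laplace (revolution_surface f) (\<lambda>s t. revolution_surface f s t $ 2) u v
             = l2 * revolution_surface f u v $ 2"
    and "\<And>u v. u \<in> I \<Longrightarrow>
           laplace (revolution_surface f) (\<lambda>s t. revolution_surface f s t $ 3) u v
             = l3 * revolution_surface f u v $ 3"
    and not_all_zero: "(l1, l2, l3) \<noteq> (0, 0, 0)"
  shows "\<exists>l. (l1, l2, l3) = (0, 0, l) \<and> l \<noteq> 0 \<and>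
           ((l > 0 \<and> (\<exists>c1 c2. \<forall>u\<in>I. generating_curve f u =
               vector [0, u, c1 * bessel_J0 (sqrt l * u) + c2 * bessel_Y0 (sqrt l * u)])) \<or>
            (l < 0 \<and> (\<exists>c1 c2. \<forall>u\<in>I. generating_curve f u =
               vector [0, u, c1 * bessel_I0 (sqrt (- l) * u) + c2 * bessel_K0 (sqrt (- l) * u)])))"
proof -
  obtain u where u: "u \<in> I" using \<open>I \<noteq> {}\<close> by blast
  then have pos: "u > 0" using \<open>I \<subseteq> {0<..}\<close> by auto
  have f0: "f differentiable (at s)" if "s \<in> I" for s
    using \<open>smooth_on_open I f\<close>[unfolded smooth_on_open_def, rule_format, of s 0] that by simp
  \<comment> \<open>The parameter \<open>v = 1\<close> stands for any with \<open>sinh v \<noteq> 0\<close>.\<close>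
  have "l1 * (u * sinh 1) = 0"
    using assms(6)[OF u, of 1] laplace_revolution_component_1[OF assms(1,4) f0 u, of 1]
    by (simp add: revolution_surface_def)
  then have l1: "l1 = 0" using pos by simp
  have "l2 * (u * cosh 0) = 0"
    using assms(7)[OF u, of 0] laplace_revolution_component_2[OF assms(1,4) f0 u, of 0]
    by (simp add: revolution_surface_def)
  then have l2: "l2 = 0" using pos by simp
  have l3: "l3 \<noteq> 0" using not_all_zero l1 l2 by simp
  have ode: "radial_ode (- l3) I f (\<lambda>u. u * deriv f u)"
    using radial_ode_generating_function[OF assms(1,4,5,8)] .
  have "convex I" using \<open>is_interval I\<close> by (rule is_interval_convex)
  show ?thesis
  proof (cases "l3 > 0")
    case True
    then show ?thesis
      using radial_ode_solution_bessel_JY[OF assms(4) \<open>convex I\<close> ode True] l1 l2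
      unfolding generating_curve_def by fastforce
  next
    case False
    then have "- l3 > 0" using l3 by simp
    then show ?thesis
      using radial_ode_solution_bessel_IK[OF assms(4) \<open>convex I\<close> ode] l1 l2
      unfolding generating_curve_def by fastforce
  qed
qed

end
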